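(* Let $d\geqslant 1$ and $s\geqslant 1$ be integers. Up to similarity, there are only finitely many $s$-distance sets $X$ in $\mathbb{R}^d$ with \[ |X|\geqslant 2\binom{d+s-1}{s-1}. \]
   Context: $\mathbb{R}^d$ is the $d$-dimensional Euclidean space with Euclidean norm $\|\cdot\|$, and $|\cdot|$ denotes cardinality. For a finite set $X\subset\mathbb{R}^d$, $A(X)=\{\|x-y\| : x,y\in X,\ x\neq y\}$ is the set of distances between distinct points of $X$. A finite set $X\subset\mathbb{R}^d$ is called an $s$-distance set if $|A(X)|=s$. Two subsets $X,Y\subset\mathbb{R}^d$ are similar if $Y=\varphi(X)$ for some map $\varphi(x)=rTx+v$ with $r>0$, $T$ an orthogonal linear map of $\mathbb{R}^d$ and $v\in\mathbb{R}^d$. The claim says that, for fixed $d$ and $s$, the $s$-distance sets satisfying the cardinality bound fall into finitely many similarity classes. *)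

theory Defs
  imports "HOL-Analysis.Analysis"
begin

definition distances :: "(real ^ 'd) set \<Rightarrow> real set" where
  "distances X = {norm (x - y) | x y. x \<in> X \<and> y \<in> X \<and> x \<noteq> y}"

definition s_distance_set :: "nat \<Rightarrow> (real ^ 'd) set \<Rightarrow> bool" where
  "s_distance_set s X \<longleftrightarrow> finite X \<and> card (distances X) = s"

definition similar :: "(real ^ 'd) set \<Rightarrow> (real ^ 'd) set \<Rightarrow> bool" where
  "similar X Y \<longleftrightarrow> (\<exists>r T v. r > 0 \<and> orthogonal_transformation T \<and>
     Y = (\<lambda>x. r *\<^sub>R T x + v) ` X)"

definition similarity :: "((real ^ 'd) set \<times> (real ^ 'd) set) set" where
  "similarity = {(X, Y). similar X Y}"

lemma similar_refl: "similar X X"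
  unfolding similar_def
  by (rule exI[of _ 1], rule exI[of _ "\<lambda>x. x"], rule exI[of _ 0])
     simp

lemma similar_sym:
  assumes "similar X Y"
  shows "similar Y X"
proof -
  obtain r T v where r: "r > 0" and T: "orthogonal_transformation T"
    and Y: "Y = (\<lambda>x. r *\<^sub>R T x + v) ` X"
    using assms unfolding similar_def by blast
  let ?S = "inv T"
  have S: "orthogonal_transformation ?S"
    using T by (rule orthogonal_transformation_inv)
  have lin: "linear ?S"
    using S by (rule orthogonal_transformation_linear)
  have ST: "?S (T x) = x" for x
    using orthogonal_transformation_inj[OF T] by (rule inv_f_f)
  have "(1 / r) *\<^sub>R ?S (r *\<^sub>R T x + v) + - ((1 / r) *\<^sub>R ?S v) = x" for x
    using r by (simp add: linear_add[OF lin] linear_cmul[OF lin] ST scaleR_right_distrib)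
  then have "X = (\<lambda>y. (1 / r) *\<^sub>R ?S y + - ((1 / r) *\<^sub>R ?S v)) ` Y"
    unfolding Y image_image by simp
  then show ?thesis
    unfolding similar_def using r S
    by (intro exI[of _ "1 / r"] exI[of _ ?S] exI[of _ "- ((1 / r) *\<^sub>R ?S v)"]) simp
qed

lemma similar_trans:
  assumes "similar X Y" and "similar Y Z"
  shows "similar X Z"
proof -
  obtain r T v where 1: "r > 0" "orthogonal_transformation T"
    and Y: "Y = (\<lambda>x. r *\<^sub>R T x + v) ` X"
    using assms(1) unfolding similar_def by blast
  obtain q U w where 2: "q > 0" "orthogonal_transformation U"
    and Z: "Z = (\<lambda>x. q *\<^sub>R U x + w) ` Y"
    using assms(2) unfolding similar_def by blast
  have lin: "linear U"
    using 2(2) by (rule orthogonal_transformation_linear)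
  have "Z = (\<lambda>x. (q * r) *\<^sub>R (U \<circ> T) x + (q *\<^sub>R U v + w)) ` X"
    unfolding Y Z image_image
    by (simp add: linear_add[OF lin] linear_cmul[OF lin] scaleR_right_distrib add.assoc)
  moreover have "orthogonal_transformation (U \<circ> T)"
    using 2(2) 1(2) by (rule orthogonal_transformation_compose)
  ultimately show ?thesis
    unfolding similar_def using 1(1) 2(1)
    by (intro exI[of _ "q * r"] exI[of _ "U \<circ> T"] exI[of _ "q *\<^sub>R U v + w"]) simp
qed

lemma equiv_similarity: "equiv UNIV similarity"
proof (rule equivI)
  show "refl similarity"
    by (simp add: refl_on_def similarity_def similar_refl)
  show "sym similarity"
    unfolding sym_def similarity_def using similar_sym by blast
  show "trans similarity"
    unfolding trans_def similarity_def using similar_trans by blast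
qed simp

end

theory Submission
  imports Defs "HOL-Computational_Algebra.Polynomial"
begin

text \<open>
  Let \<open>X\<close> be an \<open>s\<close>-distance set in \<open>\<real>\<^sup>d\<close> and let \<open>0 < a\<^sub>0 < \<dots> < a\<^sub>s\<^sub>-\<^sub>1 = 1\<close> be its squared distances,
  divided by the largest one. It suffices to confine \<open>|X|\<close> and the \<open>a\<^sub>i\<close> to finite sets: then
  only finitely many labelled distance matrices occur up to scaling, and an isometry between finite
  subsets of \<open>\<real>\<^sup>d\<close> is the restriction of a rigid motion (finite_similarity_classes).

  For fixed \<open>x\<close>, a polynomial of degree at most \<open>t\<close> in \<open>|x - y|\<^sup>2\<close> is, as a function of \<open>y\<close>, a
  combination of products of a power of \<open>|y|\<^sup>2\<close> and coordinates of \<open>y\<close>, with \<open>|y|\<^sup>2\<close> counted as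
  having degree 1. One coordinate needs to occur with exponent at most 1, so that fewer than
  \<open>2 (d + t choose t)\<close> such products suffice. If \<open>X\<close> has at least as many points as this bound, a
  nonzero weight \<open>u\<close> on \<open>X\<close> is orthogonal to all of them
  (exists_distance_polynomial_annihilator). Two choices of polynomial exploit \<open>u\<close>.

  For degree \<open>s\<close>, the polynomial vanishing at all squared distances but not at 0 would force
  \<open>u = 0\<close>; hence \<open>|X|\<close> is bounded (card_s_distance_set_le). For degree \<open>s - 1\<close>, which is
  where the cardinality hypothesis enters, take the Lagrange basis polynomial of the node \<open>a\<^sub>i\<close>. It
  shows that \<open>u\<close> is an eigenvector of the graph joining the points at normalized squared distance
  \<open>a\<^sub>i\<close>, with eigenvalue \<open>- K\<^sub>i\<close>, where \<open>K\<^sub>i = \<Prod>\<^sub>j\<^sub>\<noteq>\<^sub>i a\<^sub>j / (a\<^sub>j - a\<^sub>i)\<close> (lagrange_weight_mem). As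
  there are only finitely many graphs with boundedly many vertices, the \<open>K\<^sub>i\<close> lie in a finite set.

  It remains to recover the \<open>a\<^sub>i\<close> from the \<open>K\<^sub>i\<close> up to finitely many possibilities
  (finite_nodes_of_weights). The \<open>K\<^sub>i\<close> are the weights for which \<open>\<Sum>\<^sub>i K\<^sub>i p(a\<^sub>i) = p(0)\<close> for
  every polynomial \<open>p\<close> of degree below \<open>s\<close>. If infinitely many normalized node sequences shared the
  same weights, some of them would converge. Nodes cannot merge or tend to 0 in the limit: the limit
  equations would make some tail sum of the \<open>K\<^sub>i\<close> vanish, against Rolle's theorem
  (tail_sum_nonzero). And the equations, linearized at a nondegenerate solution, have only the
  trivial solution that keeps the last node fixed, so that such a solution is isolated
  (local_rigidity).
\<close>

section \<open>Underdetermined linear systems and eigenvalues of finite matrices\<close>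

text \<open>A homogeneous linear system with more unknowns than equations has a nonzero solution; the
  induction eliminates one equation together with one unknown.\<close>
lemma exists_nonzero_annihilator:
  fixes g :: "'i \<Rightarrow> 'a \<Rightarrow> real"
  assumes "finite I" "finite X" "card I < card X"
  shows "\<exists>u. (\<exists>x\<in>X. u x \<noteq> 0) \<and> (\<forall>i\<in>I. (\<Sum>x\<in>X. u x * g i x) = 0)"
  using assms
proof (induction I arbitrary: X g rule: finite_induct)
  case empty
  then have "X \<noteq> {}" by auto
  then show ?case by (intro exI[of _ "\<lambda>_. 1"]) auto
next
  case (insert i I)
  show ?case
  proof (cases "\<forall>x\<in>X. g i x = 0")
    case True
    have "card I < card X" using insert by simp
    then obtain u where "\<exists>x\<in>X. u x \<noteq> 0" "\<forall>j\<in>I. (\<Sum>x\<in>X. u x * g j x) = 0"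
      using insert.IH[OF insert.prems(1), of g] by blast
    with True show ?thesis by (intro exI[of _ u]) auto
  next
    case False
    then obtain z where z: "z \<in> X" "g i z \<noteq> 0" by blast
    \<comment> \<open>Subtracting multiples of equation \<open>i\<close> removes the unknown \<open>u z\<close> from the others.\<close>
    define h where "h j x = g j x - g j z / g i z * g i x" for j x
    have "card I < card (X - {z})" using insert z by simp
    then obtain u where u: "\<exists>x\<in>X-{z}. u x \<noteq> 0" "\<And>j. j \<in> I \<Longrightarrow> (\<Sum>x\<in>X-{z}. u x * h j x) = 0"
      using insert.IH[of "X - {z}" h] insert.prems(1) by blast
    define S where "S j = (\<Sum>x\<in>X-{z}. u x * g j x)" for j
    define w where "w = u(z := - S i / g i z)"
    have w: "(\<Sum>x\<in>X. w x * g j x) = - S i / g i z * g j z + S j" for j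
    proof -
      have "(\<Sum>x\<in>X-{z}. w x * g j x) = S j"
        unfolding S_def by (intro sum.cong) (auto simp: w_def)
      then show ?thesis
        using sum.remove[OF insert.prems(1) z(1), of "\<lambda>x. w x * g j x"] by (simp add: w_def)
    qed
    have "(\<Sum>x\<in>X. w x * g j x) = 0" if "j \<in> I" for j
    proof -
      have "0 = S j - g j z / g i z * S i"
        using u(2)[OF that] unfolding h_def S_def
        by (simp add: right_diff_distrib sum_subtractf sum_distrib_left mult.left_commute)
      then show ?thesis unfolding w by (simp add: field_simps)
    qed
    moreover have "(\<Sum>x\<in>X. w x * g i x) = 0" unfolding w using z by simp
    moreover have "\<exists>x\<in>X. w x \<noteq> 0" using u(1) by (auto simp: w_def)
    ultimately show ?thesis by blast
  qed
qed

text \<open>The powers of the matrix span a space of finite dimension, so some nontrivial combination of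
  them vanishes; every eigenvalue is a root of the corresponding polynomial.\<close>
lemma finite_eigenvalues:
  fixes A :: "'a \<Rightarrow> 'a \<Rightarrow> real"
  assumes V: "finite V"
  shows "finite {l. \<exists>u. (\<exists>x\<in>V. u x \<noteq> 0) \<and> (\<forall>x\<in>V. (\<Sum>y\<in>V. A x y * u y) = l * u x)}"
proof -
  define M :: "nat \<Rightarrow> 'a \<Rightarrow> 'a \<Rightarrow> real" where
    "M = rec_nat (\<lambda>x y. of_bool (x = y)) (\<lambda>_ B x y. \<Sum>z\<in>V. A x z * B z y)"
  have M0: "M 0 x y = of_bool (x = y)" for x y by (simp add: M_def)
  have MS: "M (Suc k) x y = (\<Sum>z\<in>V. A x z * M k z y)" for k x y by (simp add: M_def)
  define N where "N = card (V \<times> V)"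
  obtain c where c: "\<exists>k\<in>{..N}. c k \<noteq> 0"
    and rel: "\<And>x y. x \<in> V \<Longrightarrow> y \<in> V \<Longrightarrow> (\<Sum>k\<le>N. c k * M k x y) = 0"
    using exists_nonzero_annihilator[of "V \<times> V" "{..N}" "\<lambda>(x, y) k. M k x y"] V
    unfolding N_def by fastforce
  define p where "p = (\<Sum>k\<le>N. monom (c k) k)"
  have "coeff p k = c k" if "k \<le> N" for k
    using that by (simp add: p_def coeff_sum)
  then have p0: "p \<noteq> 0" using c by auto
  have "poly p l = 0"
    if u: "\<exists>x\<in>V. u x \<noteq> 0" and ev: "\<And>x. x \<in> V \<Longrightarrow> (\<Sum>y\<in>V. A x y * u y) = l * u x" for l u
  proof -
    have pow: "(\<Sum>y\<in>V. M k x y * u y) = l ^ k * u x" if "x \<in> V" for k x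
      using that
    proof (induction k arbitrary: x)
      case 0
      then show ?case using V by (simp add: M0)
    next
      case (Suc k)
      have "(\<Sum>y\<in>V. M (Suc k) x y * u y) = (\<Sum>y\<in>V. \<Sum>z\<in>V. A x z * (M k z y * u y))"
        by (simp add: MS sum_distrib_right mult.assoc)
      also have "\<dots> = (\<Sum>z\<in>V. A x z * (\<Sum>y\<in>V. M k z y * u y))"
        by (subst sum.swap) (simp add: sum_distrib_left)
      also have "\<dots> = (\<Sum>z\<in>V. l ^ k * (A x z * u z))"
        by (intro sum.cong) (auto simp: Suc.IH)
      also have "\<dots> = l ^ Suc k * u x"
        unfolding sum_distrib_left[symmetric] by (simp add: ev[OF Suc.prems])
      finally show ?case .
    qed
    obtain x where x: "x \<in> V" "u x \<noteq> 0" using u by blast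
    have "poly p l * u x = (\<Sum>k\<le>N. c k * (l ^ k * u x))"
      by (simp add: p_def poly_sum poly_monom sum_distrib_right mult.assoc)
    also have "\<dots> = (\<Sum>k\<le>N. \<Sum>y\<in>V. c k * M k x y * u y)"
      by (simp add: pow[OF x(1), symmetric] sum_distrib_left mult.assoc)
    also have "\<dots> = (\<Sum>y\<in>V. (\<Sum>k\<le>N. c k * M k x y) * u y)"
      by (subst sum.swap) (simp add: sum_distrib_right)
    also have "\<dots> = 0" using rel[OF x(1)] by simp
    finally show ?thesis using x by simp
  qed
  then have "{l. \<exists>u. (\<exists>x\<in>V. u x \<noteq> 0) \<and> (\<forall>x\<in>V. (\<Sum>y\<in>V. A x y * u y) = l * u x)} \<subseteq> {l. poly p l = 0}"
    by blast
  then show ?thesis using poly_roots_finite[OF p0] finite_subset by blast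
qed

text \<open>The eigenvalues of all directed graphs on \<open>{..<n}\<close> with \<open>n \<le> B\<close>. With standard vertex
  sets there are only finitely many such graphs.\<close>
definition adjacency_eigenvalues :: "nat \<Rightarrow> real set" where
  "adjacency_eigenvalues B = (\<Union>n\<le>B. \<Union>E\<in>Pow ({..<n} \<times> {..<n}).
     {l. \<exists>u. (\<exists>x\<in>{..<n}. u x \<noteq> 0) \<and>
       (\<forall>x\<in>{..<n}. (\<Sum>y\<in>{..<n}. of_bool ((x, y) \<in> E) * u y) = l * u x)})"

lemma finite_adjacency_eigenvalues: "finite (adjacency_eigenvalues B)"
  unfolding adjacency_eigenvalues_def
  by (intro finite_UN_I finite_eigenvalues) auto

lemma adjacency_eigenvaluesI:
  assumes X: "finite X" "card X \<le> B" and u: "x0 \<in> X" "u x0 \<noteq> 0"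
    and ev: "\<And>x. x \<in> X \<Longrightarrow> (\<Sum>y\<in>X. of_bool (R x y) * u y) = l * u x"
  shows "l \<in> adjacency_eigenvalues B"
proof -
  define n where "n = card X"
  obtain e where e: "bij_betw e {..<n} X"
    using ex_bij_betw_nat_finite[OF X(1)] unfolding n_def lessThan_atLeast0 by blast
  define E where "E = {(i, j). i < n \<and> j < n \<and> R (e i) (e j)}"
  obtain i0 where i0: "i0 < n" "e i0 = x0"
    using e u(1) unfolding bij_betw_def by (auto simp: image_iff)
  have "(\<Sum>j\<in>{..<n}. of_bool ((i, j) \<in> E) * (u \<circ> e) j) = l * (u \<circ> e) i" if "i < n" for i
  proof -
    have "(\<Sum>j\<in>{..<n}. of_bool ((i, j) \<in> E) * (u \<circ> e) j) = (\<Sum>j\<in>{..<n}. of_bool (R (e i) (e j)) * u (e j))"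
      using that by (intro sum.cong) (auto simp: E_def)
    also have "\<dots> = (\<Sum>y\<in>X. of_bool (R (e i) y) * u y)"
      by (rule sum.reindex_bij_betw[OF e])
    also have "\<dots> = l * u (e i)"
      using ev e that by (auto simp: bij_betw_def)
    finally show ?thesis by simp
  qed
  moreover have "\<exists>i\<in>{..<n}. (u \<circ> e) i \<noteq> 0" using i0 u(2) by auto
  moreover have "E \<in> Pow ({..<n} \<times> {..<n})" "n \<le> B" using X by (auto simp: E_def n_def)
  ultimately show ?thesis
    unfolding adjacency_eigenvalues_def by blast
qed


section \<open>Polynomials in the squared distance\<close>

text \<open>A monomial in \<open>|y|\<^sup>2\<close> and the coordinates of \<open>y\<close>. Because of \<open>(y $ k)\<^sup>2 = |y|\<^sup>2 - \<Sum>\<^sub>i\<^sub>\<noteq>\<^sub>k (y $ i)\<^sup>2\<close> the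
  coordinate \<open>k\<close> is needed only with exponent 0 or 1, which the Boolean records; the entry \<open>b k\<close> is
  thereby free to hold the exponent of \<open>|y|\<^sup>2\<close>.\<close>
definition quadric_monomial :: "'d::finite \<Rightarrow> ('d \<Rightarrow> nat) \<times> bool \<Rightarrow> real ^ 'd \<Rightarrow> real" where
  "quadric_monomial k = (\<lambda>(b, e) y.
     ((norm y)\<^sup>2) ^ b k * (\<Prod>i\<in>UNIV - {k}. (y $ i) ^ b i) * (if e then y $ k else 1))"

text \<open>The factor \<open>|y|\<^sup>2\<close> counts as degree 1, so that \<open>|x - y|\<^sup>2\<close> has degree 1 in \<open>y\<close>.\<close>
definition monomial_degree :: "('d::finite \<Rightarrow> nat) \<times> bool \<Rightarrow> nat" where
  "monomial_degree = (\<lambda>(b, e). (\<Sum>i\<in>UNIV. b i) + of_bool e)"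

lemma monomial_degree_upd:
  "monomial_degree (b(i := Suc (b i)), e) = Suc (monomial_degree (b, e))"
proof -
  have "(\<Sum>j\<in>UNIV. (b(i := Suc (b i))) j) = Suc (b i) + (\<Sum>j\<in>UNIV - {i}. b j)"
    by (subst sum.remove[of UNIV i]) (auto intro!: sum.cong)
  also have "\<dots> = Suc (\<Sum>j\<in>UNIV. b j)"
    using sum.remove[of UNIV i b] by simp
  finally show ?thesis by (simp add: monomial_degree_def)
qed

lemma quadric_monomial_mult_norm:
  "(norm y)\<^sup>2 * quadric_monomial k (b, e) y = quadric_monomial k (b(k := Suc (b k)), e) y"
proof -
  have "(\<Prod>i\<in>UNIV - {k}. (y $ i) ^ (b(k := Suc (b k))) i) = (\<Prod>i\<in>UNIV - {k}. (y $ i) ^ b i)"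
    by (intro prod.cong) auto
  then show ?thesis by (simp add: quadric_monomial_def mult_ac)
qed

lemma quadric_monomial_mult_coordinate:
  assumes "i \<noteq> k"
  shows "y $ i * quadric_monomial k (b, e) y = quadric_monomial k (b(i := Suc (b i)), e) y"
proof -
  have i: "i \<in> UNIV - {k}" using assms by simp
  have "(\<Prod>j\<in>UNIV - {k}. (y $ j) ^ (b(i := Suc (b i))) j)
      = (y $ i) ^ Suc (b i) * (\<Prod>j\<in>UNIV - {k} - {i}. (y $ j) ^ b j)"
    by (subst prod.remove[OF _ i]) (auto intro!: prod.cong)
  also have "\<dots> = y $ i * (\<Prod>j\<in>UNIV - {k}. (y $ j) ^ b j)"
    using prod.remove[OF _ i, of "\<lambda>j. (y $ j) ^ b j"] by (simp add: mult_ac)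
  finally show ?thesis using assms by (simp add: quadric_monomial_def mult_ac)
qed

lemma quadric_monomial_mult_special_coordinate:
  "y $ k * quadric_monomial k (b, False) y = quadric_monomial k (b, True) y"
  by (simp add: quadric_monomial_def mult_ac)

lemma norm_diff_expand:
  fixes x y :: "real ^ 'd"
  shows "(norm (x - y))\<^sup>2 = (norm x)\<^sup>2 - 2 * (\<Sum>i\<in>UNIV. x $ i * y $ i) + (norm y)\<^sup>2"
  by (simp add: power2_norm_eq_inner inner_diff_left inner_diff_right inner_commute[of y x])
    (simp add: inner_vec_def)

text \<open>Multiplication by \<open>|x - y|\<^sup>2 = |x|\<^sup>2 - 2 x \<bullet> y + |y|\<^sup>2\<close> raises the degree of the span of the monomials
  by at most one. The induction runs over the exponent \<open>j\<close> with an additional monomial factor, and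
  multiplies that factor by one copy of \<open>|x - y|\<^sup>2\<close> at a time.\<close>
lemma annihilates_distance_powers:
  fixes X :: "(real ^ 'd) set" and u :: "real ^ 'd \<Rightarrow> real"
  assumes ann: "\<And>m. monomial_degree m \<le> t \<Longrightarrow> (\<Sum>y\<in>X. u y * quadric_monomial k m y) = 0"
  shows "monomial_degree m + j \<le> t \<Longrightarrow>
    (\<Sum>y\<in>X. u y * (quadric_monomial k m y * ((norm (x - y))\<^sup>2) ^ j)) = 0"
proof (induction j arbitrary: m)
  case 0
  then show ?case using ann by simp
next
  case (Suc j)
  define q where "q y = ((norm (x - y))\<^sup>2) ^ j" for y
  define L where "L h = (\<Sum>y\<in>X. u y * (h y * q y))" for h
  have L_add: "L (\<lambda>y. g y + h y) = L g + L h" for g h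
    by (simp add: L_def algebra_simps sum.distrib)
  have L_diff: "L (\<lambda>y. g y - h y) = L g - L h" for g h
    by (simp add: L_def algebra_simps sum_subtractf)
  have L_cmul: "L (\<lambda>y. c * h y) = c * L h" for c h
    by (simp add: L_def sum_distrib_left mult_ac)
  have L_sum: "L (\<lambda>y. \<Sum>i\<in>I. h i y) = (\<Sum>i\<in>I. L (h i))" for h :: "'d \<Rightarrow> real ^ 'd \<Rightarrow> real" and I
    unfolding L_def sum_distrib_right sum_distrib_left by (rule sum.swap)
  have IH: "L (quadric_monomial k m') = 0" if "monomial_degree m' + j \<le> t" for m'
    using Suc.IH[OF that] by (simp add: L_def q_def)
  obtain b e where m: "m = (b, e)" by (cases m)
  let ?m = "quadric_monomial k m"
  have deg: "monomial_degree (b, e) + Suc j \<le> t" using Suc.prems m by simp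
  have L0: "L ?m = 0" using IH deg m by simp
  have Ln: "L (\<lambda>y. (norm y)\<^sup>2 * ?m y) = 0"
    unfolding m quadric_monomial_mult_norm using deg by (intro IH) (simp add: monomial_degree_upd)
  have Lc: "L (\<lambda>y. y $ i * ?m y) = 0" for i
  proof (cases "i = k")
    case False
    then show ?thesis
      unfolding m quadric_monomial_mult_coordinate[OF False] using deg
      by (intro IH) (simp add: monomial_degree_upd)
  next
    case i: True
    show ?thesis
    proof (cases e)
      case False
      then show ?thesis
        using deg unfolding m i by (simp add: quadric_monomial_mult_special_coordinate)
          (intro IH, simp add: monomial_degree_def)
    next
      case True
      \<comment> \<open>The square of the special coordinate is replaced by
        \<open>\<bar>y\<bar>\<^sup>2\<close> minus the squares of the other coordinates.\<close>
      let ?b = "quadric_monomial k (b, False)"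
      have sq: "(y $ k)\<^sup>2 = (norm y)\<^sup>2 - (\<Sum>i\<in>UNIV - {k}. (y $ i)\<^sup>2)" for y :: "real ^ 'd"
      proof -
        have "(norm y)\<^sup>2 = (\<Sum>i\<in>UNIV. (y $ i)\<^sup>2)"
          by (simp add: power2_norm_eq_inner inner_vec_def flip: power2_eq_square)
        then show ?thesis by (simp add: sum.remove[of UNIV k])
      qed
      have "(\<lambda>y. y $ i * ?m y) = (\<lambda>y. (norm y)\<^sup>2 * ?b y - (\<Sum>i\<in>UNIV - {k}. y $ i * (y $ i * ?b y)))"
      proof
        fix y :: "real ^ 'd"
        have "y $ i * ?m y = (y $ k)\<^sup>2 * ?b y"
          unfolding m i using True
          by (simp add: quadric_monomial_mult_special_coordinate[symmetric] power2_eq_square)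
        also have "\<dots> = (norm y)\<^sup>2 * ?b y - (\<Sum>i\<in>UNIV - {k}. y $ i * (y $ i * ?b y))"
          unfolding sq by (simp add: left_diff_distrib sum_distrib_right power2_eq_square mult.assoc)
        finally show "y $ i * ?m y = (norm y)\<^sup>2 * ?b y - (\<Sum>i\<in>UNIV - {k}. y $ i * (y $ i * ?b y))" .
      qed
      moreover have db: "monomial_degree (b, False) + 2 + j \<le> t"
        using deg True by (simp add: monomial_degree_def)
      have "L (\<lambda>y. (norm y)\<^sup>2 * ?b y) = 0"
        unfolding quadric_monomial_mult_norm using db by (intro IH) (simp add: monomial_degree_upd)
      moreover have "L (\<lambda>y. y $ i * (y $ i * ?b y)) = 0" if "i \<in> UNIV - {k}" for i
      proof -
        have ik: "i \<noteq> k" using that by simp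
        show ?thesis
          unfolding quadric_monomial_mult_coordinate[OF ik]
          using db monomial_degree_upd[of "b(i := Suc (b i))" i False] monomial_degree_upd[of b i False]
          by (intro IH) linarith
      qed
      ultimately show ?thesis by (simp add: L_diff L_sum)
    qed
  qed
  have "(\<Sum>y\<in>X. u y * (?m y * ((norm (x - y))\<^sup>2) ^ Suc j))
      = L (\<lambda>y. (norm x)\<^sup>2 * ?m y - (\<Sum>i\<in>UNIV. 2 * x $ i * (y $ i * ?m y)) + (norm y)\<^sup>2 * ?m y)"
    unfolding L_def
  proof (intro sum.cong refl arg_cong[where f = "\<lambda>z. u _ * z"])
    fix y
    have s: "(\<Sum>i\<in>UNIV. 2 * x $ i * (y $ i * ?m y)) = 2 * (\<Sum>i\<in>UNIV. x $ i * y $ i) * ?m y"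
      by (simp add: sum_distrib_left sum_distrib_right mult_ac)
    show "?m y * ((norm (x - y))\<^sup>2) ^ Suc j
      = ((norm x)\<^sup>2 * ?m y - (\<Sum>i\<in>UNIV. 2 * x $ i * (y $ i * ?m y)) + (norm y)\<^sup>2 * ?m y) * q y"
      unfolding s q_def power_Suc by (subst norm_diff_expand) (simp add: algebra_simps)
  qed
  also have "\<dots> = 0"
    unfolding L_add L_diff L_sum L_cmul L0 Ln Lc by simp
  finally show ?case .
qed

lemma finite_bounded_exponents: "finite {b :: 'd::finite \<Rightarrow> nat. (\<Sum>i\<in>UNIV. b i) \<le> t}"
proof (rule finite_subset)
  show "{b :: 'd \<Rightarrow> nat. (\<Sum>i\<in>UNIV. b i) \<le> t} \<subseteq> UNIV \<rightarrow>\<^sub>E {..t}"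
  proof (safe; simp)
    fix b :: "'d \<Rightarrow> nat" and i
    assume "sum b UNIV \<le> t"
    moreover have "b i \<le> sum b UNIV" by (rule member_le_sum) auto
    ultimately show "b i \<le> t" by simp
  qed
  show "finite ((UNIV :: 'd set) \<rightarrow>\<^sub>E {..t})" by (intro finite_PiE) auto
qed

text \<open>Stars and bars: the slack \<open>t - \<Sum>\<^sub>i b\<^sub>i\<close> is an additional entry.\<close>
lemma card_bounded_exponents:
  "card {b :: 'd::finite \<Rightarrow> nat. (\<Sum>i\<in>UNIV. b i) \<le> t} \<le> (CARD('d) + t) choose t"
proof -
  let ?B = "{b :: 'd \<Rightarrow> nat. (\<Sum>i\<in>UNIV. b i) \<le> t}"
  let ?L = "{l :: nat list. length l = Suc CARD('d) \<and> sum_list l = t}"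
  obtain xs :: "'d list" where xs: "set xs = UNIV" "distinct xs"
    using finite_distinct_list[of "UNIV :: 'd set"] by auto
  have len: "length xs = CARD('d)" using distinct_card[OF xs(2)] xs(1) by simp
  have sl: "sum_list (map b xs) = (\<Sum>i\<in>UNIV. b i)" for b :: "'d \<Rightarrow> nat"
    using sum_list_distinct_conv_sum_set[OF xs(2), of b] xs(1) by simp
  let ?f = "\<lambda>b. (t - (\<Sum>i\<in>UNIV. b i)) # map b xs"
  have "inj_on ?f ?B"
    by (rule inj_onI, rule ext) (use xs(1) in \<open>auto simp: map_eq_conv\<close>)
  moreover have "?f ` ?B \<subseteq> ?L" by (auto simp: len sl)
  moreover have "finite ?L"
    by (rule finite_subset[OF _ finite_lists_length_eq[of "{..t}" "Suc CARD('d)"]])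
      (auto dest: member_le_sum_list)
  ultimately have "card ?B \<le> card ?L" by (rule card_inj_on_le)
  then show ?thesis by (simp add: card_length_sum_list add.commute)
qed

lemma bounded_monomials_eq:
  "{m :: ('d::finite \<Rightarrow> nat) \<times> bool. monomial_degree m \<le> t} =
    {b. (\<Sum>i\<in>UNIV. b i) \<le> t} \<times> {False} \<union> {b. (\<Sum>i\<in>UNIV. b i) < t} \<times> {True}"
proof (intro set_eqI)
  fix m :: "('d \<Rightarrow> nat) \<times> bool"
  obtain b e where "m = (b, e)" by (cases m)
  then show "m \<in> {m. monomial_degree m \<le> t} \<longleftrightarrow>
      m \<in> {b. (\<Sum>i\<in>UNIV. b i) \<le> t} \<times> {False} \<union> {b. (\<Sum>i\<in>UNIV. b i) < t} \<times> {True}"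
    by (cases e) (auto simp: monomial_degree_def)
qed

lemma finite_bounded_monomials:
  "finite {m :: ('d::finite \<Rightarrow> nat) \<times> bool. monomial_degree m \<le> t}"
proof -
  have "finite {b :: 'd \<Rightarrow> nat. (\<Sum>i\<in>UNIV. b i) < t}"
    by (rule finite_subset[OF _ finite_bounded_exponents[of t]]) auto
  then show ?thesis
    unfolding bounded_monomials_eq using finite_bounded_exponents by blast
qed

text \<open>The monomials without the special coordinate correspond to the exponents of total degree at most
  \<open>t\<close>, and the others to those of total degree less than \<open>t\<close>. The latter are strictly fewer, which
  gives the strict inequality.\<close>
lemma card_bounded_monomials:
  "card {m :: ('d::finite \<Rightarrow> nat) \<times> bool. monomial_degree m \<le> t} < 2 * ((CARD('d) + t) choose t)"
proof -
  let ?B = "{b :: 'd \<Rightarrow> nat. (\<Sum>i\<in>UNIV. b i) \<le> t}" and ?C = "{b :: 'd \<Rightarrow> nat. (\<Sum>i\<in>UNIV. b i) < t}"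
  obtain k :: 'd where True by simp
  have "(\<Sum>i\<in>UNIV. if i = k then t else 0) = t" by simp
  then have "(\<lambda>i. if i = k then t else 0) \<in> ?B - ?C" by simp
  then have "?C \<subset> ?B" by (intro psubsetI) (auto simp del: sum.delta sum.delta')
  then have C: "card ?C < card ?B" using finite_bounded_exponents by (rule psubset_card_mono[rotated])
  have "card {m :: ('d \<Rightarrow> nat) \<times> bool. monomial_degree m \<le> t} \<le> card (?B \<times> {False}) + card (?C \<times> {True})"
    unfolding bounded_monomials_eq by (rule card_Un_le)
  also have "\<dots> < 2 * card ?B" using C by (simp add: card_cartesian_product)
  also have "\<dots> \<le> 2 * ((CARD('d) + t) choose t)" using card_bounded_exponents by simp
  finally show ?thesis .
qed

text \<open>There are more points than monomials, so some nonzero weight is orthogonal to all monomials. The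
  lemma \<open>annihilates_distance_powers\<close>, with the constant monomial as the additional factor, extends this to powers of the
  squared distance. The factor \<open>c\<close> allows distances to be rescaled without moving the points.\<close>
lemma exists_distance_polynomial_annihilator:
  fixes X :: "(real ^ 'd) set"
  assumes X: "finite X" and big: "card {m :: ('d \<Rightarrow> nat) \<times> bool. monomial_degree m \<le> t} < card X"
  obtains u z where "z \<in> X" "u z \<noteq> 0"
    "\<And>p c x. degree p \<le> t \<Longrightarrow> (\<Sum>y\<in>X. poly p (c * (norm (x - y))\<^sup>2) * u y) = 0"
proof -
  obtain k :: 'd where True by simp
  obtain u z where z: "z \<in> X" "u z \<noteq> 0"
    and ann: "\<And>m. monomial_degree m \<le> t \<Longrightarrow> (\<Sum>y\<in>X. u y * quadric_monomial k m y) = 0"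
    using exists_nonzero_annihilator[OF finite_bounded_monomials X big, of "quadric_monomial k"] by auto
  have pow: "(\<Sum>y\<in>X. u y * ((norm (x - y))\<^sup>2) ^ j) = 0" if "j \<le> t" for x j
  proof -
    have "monomial_degree (\<lambda>_::'d. 0, False) + j \<le> t" using that by (simp add: monomial_degree_def)
    from annihilates_distance_powers[OF ann this, of x] show ?thesis
      by (simp add: quadric_monomial_def)
  qed
  have "(\<Sum>y\<in>X. poly p (c * (norm (x - y))\<^sup>2) * u y) = 0" if "degree p \<le> t" for p c x
  proof -
    have "(\<Sum>y\<in>X. poly p (c * (norm (x - y))\<^sup>2) * u y)
        = (\<Sum>y\<in>X. \<Sum>j\<le>degree p. coeff p j * c ^ j * (u y * ((norm (x - y))\<^sup>2) ^ j))"
      by (simp add: poly_altdef sum_distrib_left power_mult_distrib mult_ac)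
    also have "\<dots> = (\<Sum>j\<le>degree p. coeff p j * c ^ j * (\<Sum>y\<in>X. u y * ((norm (x - y))\<^sup>2) ^ j))"
      by (subst sum.swap) (simp add: sum_distrib_left)
    also have "\<dots> = 0" using that pow by simp
    finally show ?thesis .
  qed
  with z that show ?thesis by blast
qed


section \<open>Extrapolation weights determine their nodes\<close>

definition lagrange_basis :: "nat \<Rightarrow> (nat \<Rightarrow> real) \<Rightarrow> nat \<Rightarrow> real poly" where
  "lagrange_basis s a i = (\<Prod>j\<in>{..<s} - {i}. smult (inverse (a i - a j)) [:- a j, 1:])"

lemma poly_lagrange_basis:
  "poly (lagrange_basis s a i) x = (\<Prod>j\<in>{..<s} - {i}. (x - a j) / (a i - a j))"
  unfolding lagrange_basis_def poly_prod
  by (intro prod.cong refl) (simp add: divide_inverse algebra_simps)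

lemma poly_lagrange_basis_node:
  assumes "inj_on a {..<s}" "i < s" "j < s"
  shows "poly (lagrange_basis s a i) (a j) = of_bool (i = j)"
proof (cases "i = j")
  case True
  have "a i - a k \<noteq> 0" if "k \<in> {..<s} - {i}" for k
    using inj_onD[OF assms(1), of i k] assms(2) that by auto
  then show ?thesis using True by (simp add: poly_lagrange_basis)
next
  case False
  then show ?thesis using assms by (auto simp: poly_lagrange_basis intro!: bexI[of _ j])
qed

lemma degree_lagrange_basis: "i < s \<Longrightarrow> degree (lagrange_basis s a i) < s"
proof -
  assume i: "i < s"
  have "degree (lagrange_basis s a i) \<le> (\<Sum>j\<in>{..<s} - {i}. 1)"
    unfolding lagrange_basis_def
    by (rule order.trans[OF degree_prod_sum_le])
      (simp, intro sum_mono, simp only: o_def, rule order.trans[OF degree_smult_le], simp)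
  then show ?thesis using i by simp
qed

lemma lagrange_interpolation:
  assumes "inj_on a {..<s}" "degree p < s"
  shows "p = (\<Sum>i<s. smult (poly p (a i)) (lagrange_basis s a i))"
proof (rule poly_eqI_degree[where A = "a ` {..<s}"])
  have c: "card (a ` {..<s}) = s" using card_image[OF assms(1)] by simp
  then show "degree p < card (a ` {..<s})" using assms(2) by simp
  show "degree (\<Sum>i<s. smult (poly p (a i)) (lagrange_basis s a i)) < card (a ` {..<s})"
    unfolding c using assms(2)
    by (intro degree_sum_less) (auto intro: le_less_trans[OF degree_smult_le] degree_lagrange_basis)
  show "poly p x = poly (\<Sum>i<s. smult (poly p (a i)) (lagrange_basis s a i)) x"
    if "x \<in> a ` {..<s}" for x
    using that assms(1)
    by (auto simp: poly_sum poly_lagrange_basis_node of_bool_def if_distrib sum.delta cong: if_cong)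
qed

text \<open>Evaluation at 0 of a polynomial of degree below \<open>s\<close>, from its values at the nodes. For distinct
  nodes the weights are unique, namely the values at 0 of the Lagrange basis.\<close>
definition extrapolates :: "nat \<Rightarrow> (nat \<Rightarrow> real) \<Rightarrow> (nat \<Rightarrow> real) \<Rightarrow> bool" where
  "extrapolates s K a \<longleftrightarrow> (\<forall>p. degree p < s \<longrightarrow> (\<Sum>i<s. K i * poly p (a i)) = poly p 0)"

lemma extrapolates_lagrange_weights:
  assumes "inj_on a {..<s}"
  shows "extrapolates s (\<lambda>i. poly (lagrange_basis s a i) 0) a"
  unfolding extrapolates_def
proof (intro allI impI)
  fix p :: "real poly" assume "degree p < s"
  from lagrange_interpolation[OF assms this]
  have "poly p 0 = poly (\<Sum>i<s. smult (poly p (a i)) (lagrange_basis s a i)) 0" by simp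
  then show "(\<Sum>i<s. poly (lagrange_basis s a i) 0 * poly p (a i)) = poly p 0"
    by (simp add: poly_sum mult.commute)
qed

lemma extrapolates_nonzero:
  assumes "extrapolates s K a" "inj_on a {..<s}" "\<And>j. j < s \<Longrightarrow> a j \<noteq> 0" "i < s"
  shows "K i \<noteq> 0"
proof -
  have "(\<Sum>j<s. K j * poly (lagrange_basis s a i) (a j)) = poly (lagrange_basis s a i) 0"
    using assms(1,4) degree_lagrange_basis unfolding extrapolates_def by blast
  also have "(\<Sum>j<s. K j * poly (lagrange_basis s a i) (a j)) = (\<Sum>j<s. if j = i then K j else 0)"
    using assms by (intro sum.cong) (auto simp: poly_lagrange_basis_node)
  also have "\<dots> = K i" using assms(4) by simp
  finally have "K i = poly (lagrange_basis s a i) 0" .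
  moreover have "(0 - a j) / (a i - a j) \<noteq> 0" if "j \<in> {..<s} - {i}" for j
    using assms(3)[of j] inj_onD[OF assms(2), of i j] that assms(4) by auto
  ultimately show ?thesis by (auto simp: poly_lagrange_basis)
qed

lemma exists_antiderivative:
  fixes q :: "real poly"
  obtains p where "pderiv p = q" "degree p \<le> Suc (degree q)"
proof
  let ?p = "\<Sum>k\<le>degree q. monom (coeff q k / of_nat (Suc k)) (Suc k)"
  show "pderiv ?p = q"
  proof (rule poly_eqI)
    fix n
    have "coeff ?p (Suc n) = (\<Sum>k\<le>degree q. if k = n then coeff q n / of_nat (Suc n) else 0)"
      unfolding coeff_sum by (intro sum.cong) auto
    then show "coeff (pderiv ?p) n = coeff q n"
      by (auto simp: coeff_pderiv coeff_eq_0 simp del: of_nat_Suc)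
  qed
  show "degree ?p \<le> Suc (degree q)"
    by (intro degree_sum_le) (auto intro: order.trans[OF degree_monom_le])
qed

text \<open>The tail sum is \<open>p(0)\<close> for the polynomial \<open>p\<close> of degree below \<open>s\<close> that interpolates the values 0 at
  the nodes before \<open>a\<^sub>k\<close> and 1 from \<open>a\<^sub>k\<close> on. If \<open>p(0) = 0\<close>, then Rolle's theorem gives \<open>p\<close> more critical points
  than its degree permits.\<close>
lemma tail_sum_nonzero:
  assumes ex: "extrapolates s K a" and mono: "strict_mono_on {..<s} a"
    and pos: "\<And>i. i < s \<Longrightarrow> 0 < a i" and k: "k < s"
  shows "(\<Sum>i\<in>{k..<s}. K i) \<noteq> 0"
proof
  assume zero: "(\<Sum>i\<in>{k..<s}. K i) = 0"
  have inj: "inj_on a {..<s}" using mono by (rule strict_mono_on_imp_inj_on)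
  define p where "p = (\<Sum>i\<in>{k..<s}. lagrange_basis s a i)"
  have deg: "degree p < s"
    unfolding p_def using k by (intro degree_sum_less) (auto intro: degree_lagrange_basis)
  have node: "poly p (a j) = of_bool (k \<le> j)" if "j < s" for j
  proof -
    have "poly p (a j) = (\<Sum>i\<in>{k..<s}. if i = j then 1 else 0)"
      unfolding p_def poly_sum using that inj
      by (intro sum.cong) (auto simp: poly_lagrange_basis_node)
    then show ?thesis using that by auto
  qed
  have "poly p 0 = (\<Sum>i<s. K i * of_bool (k \<le> i))"
    using ex deg node unfolding extrapolates_def by (metis (no_types, lifting) lessThan_iff sum.cong)
  also have "\<dots> = (\<Sum>i\<in>{k..<s}. K i)"
    by (rule sum.mono_neutral_cong_right) auto
  finally have p0: "poly p 0 = 0" using zero by simp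
  \<comment> \<open>The nodes preceded by the origin; \<open>p\<close> takes equal values at consecutive ones
    except where it jumps from 0 to 1.\<close>
  define b where "b i = (if i = 0 then 0 else a (i - 1))" for i
  have b_less: "b i < b j" if "i < j" "j \<le> s" for i j
    using that pos[of "j - 1"] strict_mono_onD[OF mono, of "i - 1" "j - 1"] by (auto simp: b_def)
  have b_val: "poly p (b i) = of_bool (k < i)" if "i \<le> s" for i
    using that node[of "i - 1"] p0 by (auto simp: b_def)
  have "\<exists>x. b i < x \<and> x < b (Suc i) \<and> poly (pderiv p) x = 0" if "i \<in> {..<s} - {k}" for i
  proof -
    have lt: "b i < b (Suc i)" using that by (intro b_less) auto
    have "poly p (b (Suc i)) = poly p (b i)"
      using that by (auto simp: b_val)
    then show ?thesis using poly_MVT[OF lt, of p] lt by auto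
  qed
  then obtain z where z: "\<And>i. i \<in> {..<s} - {k} \<Longrightarrow> b i < z i \<and> z i < b (Suc i) \<and> poly (pderiv p) (z i) = 0"
    by metis
  have z_less: "z i < z j" if "i \<in> {..<s} - {k}" "j \<in> {..<s} - {k}" "i < j" for i j
  proof -
    have "b (Suc i) \<le> b j" using b_less[of "Suc i" j] that by (cases "Suc i = j") auto
    with z[OF that(1)] z[OF that(2)] show ?thesis by linarith
  qed
  have "inj_on z ({..<s} - {k})"
    by (rule inj_onI) (metis less_irrefl linorder_neqE_nat z_less)
  then have card: "card (z ` ({..<s} - {k})) = s - 1" using k by (simp add: card_image)
  have "pderiv p = 0"
  proof (rule ccontr)
    assume nz: "pderiv p \<noteq> 0"
    have "s - 1 \<le> card {x. poly (pderiv p) x = 0}"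
      unfolding card[symmetric] using z by (intro card_mono poly_roots_finite[OF nz]) auto
    also have "\<dots> \<le> degree (pderiv p)" by (rule card_poly_roots_bound[OF nz])
    finally have "degree p = 0" using deg by (simp add: degree_pderiv)
    then show False using nz by (simp add: pderiv_eq_0_iff)
  qed
  then obtain c where "p = [:c:]" by (metis pderiv_iszero)
  then show False using p0 node[OF k] by simp
qed

text \<open>Suppose that nodes \<open>a n\<close> with the weights \<open>K\<close> tend to \<open>b\<close>. Testing the equations on a polynomial
  \<open>p\<^sub>i\<close> whose derivative is 1 at \<open>b\<^sub>i\<close> and 0 at the other nodes, except for the fixed last one,
  isolates \<open>K\<^sub>i (a n i - b\<^sub>i)\<close> up to an error that is small relative to the largest displacement.
  For the index \<open>i\<close> of the largest displacement this forces the displacement to be 0.\<close>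
lemma local_rigidity:
  assumes ex_b: "extrapolates s K b" and mono: "strict_mono_on {..<s} b"
    and pos: "\<And>i. i < s \<Longrightarrow> 0 < b i"
    and ex_a: "\<And>n. extrapolates s K (a n)"
    and top: "\<And>n. a n (s - 1) = b (s - 1)"
    and lim: "\<And>i. i < s \<Longrightarrow> (\<lambda>n. a n i) \<longlonglongrightarrow> b i"
  shows "\<forall>\<^sub>F n in sequentially. \<forall>i<s. a n i = b i"
proof (cases "s = 0")
  case False
  define r where "r = s - 1"
  have s: "s = Suc r" using False by (simp add: r_def)
  have inj: "inj_on b {..<s}" using mono by (rule strict_mono_on_imp_inj_on)
  then have inj': "inj_on b {..<r}" by (rule inj_on_subset) (auto simp: s)
  have K: "K i \<noteq> 0" if "i < s" for i
    using extrapolates_nonzero[OF ex_b inj _ that] pos by fastforce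
  have "\<exists>p. degree p < s \<and> (\<forall>j<r. poly (pderiv p) (b j) = of_bool (i = j))" if i: "i < r" for i
  proof -
    obtain p where "pderiv p = lagrange_basis r b i" "degree p \<le> Suc (degree (lagrange_basis r b i))"
      by (rule exists_antiderivative)
    then show ?thesis
      using degree_lagrange_basis[OF i, of b] poly_lagrange_basis_node[OF inj' i]
      by (intro exI[of _ p]) (auto simp: s)
  qed
  then obtain p where p: "\<And>i. i < r \<Longrightarrow> degree (p i) < s"
    "\<And>i j. i < r \<Longrightarrow> j < r \<Longrightarrow> poly (pderiv (p i)) (b j) = of_bool (i = j)"
    by metis
  \<comment> \<open>The errors are weighted by the \<open>|K\<^sub>j|\<close> and must add up to at most half of the main term;
    the summand 1 keeps \<open>C\<close> positive when there is no free node.\<close>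
  define C where "C = (\<Sum>j<r. \<bar>K j\<bar>) + 1"
  have C: "C > 0" unfolding C_def by (intro add_nonneg_pos sum_nonneg) auto
  define h where "h i = \<bar>K i\<bar> / (2 * C)" for i
  have hpos: "h i > 0" if "i < r" for i using that C K[of i] by (simp add: h_def s)
  define good where "good n i j \<longleftrightarrow>
    \<bar>poly (p i) (a n j) - poly (p i) (b j) - of_bool (i = j) * (a n j - b j)\<bar> \<le> h i * \<bar>a n j - b j\<bar>" for n i j
  have "\<forall>\<^sub>F n in sequentially. good n i j" if i: "i < r" and j: "j < r" for i j
  proof -
    have "(poly (p i) has_derivative (\<lambda>x. of_bool (i = j) * x)) (at (b j))"
      using poly_DERIV[of "p i" "b j"] unfolding p(2)[OF i j] has_field_derivative_def by simp
    then obtain d where d: "d > 0" "\<And>y. \<bar>y - b j\<bar> < d \<Longrightarrow>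
        \<bar>poly (p i) y - poly (p i) (b j) - of_bool (i = j) * (y - b j)\<bar> \<le> h i * \<bar>y - b j\<bar>"
      unfolding has_derivative_at_alt using hpos[OF i] by (auto simp: real_norm_def)
    have "\<forall>\<^sub>F n in sequentially. dist (a n j) (b j) < d"
      using lim[of j] d(1) j by (intro tendstoD) (auto simp: s)
    then show ?thesis
      by eventually_elim (use d(2) in \<open>auto simp: good_def dist_real_def\<close>)
  qed
  then have "\<forall>\<^sub>F n in sequentially. \<forall>i\<in>{..<r}. \<forall>j\<in>{..<r}. good n i j"
    by (intro eventually_ball_finite ballI) auto
  then show ?thesis
  proof eventually_elim
    case (elim n)
    define v where "v j = a n j - b j" for j
    have top': "a n r = b r" using top[of n] by (simp add: r_def)
    show ?case
    proof (cases "r = 0")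
      case True
      then show ?thesis using top' by (simp add: s)
    next
      case False
      obtain i where i: "i < r" and max: "\<And>j. j < r \<Longrightarrow> \<bar>v j\<bar> \<le> \<bar>v i\<bar>"
      proof -
        have fin: "finite ((\<lambda>j. \<bar>v j\<bar>) ` {..<r})" and ne: "(\<lambda>j. \<bar>v j\<bar>) ` {..<r} \<noteq> {}" using False by auto
        from Max_in[OF fin ne] obtain i where "i < r" "Max ((\<lambda>j. \<bar>v j\<bar>) ` {..<r}) = \<bar>v i\<bar>" by auto
        then show ?thesis using that Max_ge[OF fin] by (metis imageI lessThan_iff)
      qed
      define w where "w j = poly (p i) (a n j) - poly (p i) (b j)" for j
      have "(\<Sum>j<s. K j * w j) = 0"
        using ex_a[of n] ex_b p(1)[OF i]
        by (simp add: w_def extrapolates_def right_diff_distrib sum_subtractf)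
      then have sum0: "(\<Sum>j<r. K j * w j) = 0" by (simp add: s w_def top')
      have "K i * v i = (\<Sum>j<r. if j = i then K j * v j else 0)" using i by simp
      also have "\<dots> = (\<Sum>j<r. K j * (of_bool (i = j) * v j))" by (intro sum.cong) auto
      finally have "K i * v i = - (\<Sum>j<r. K j * (w j - of_bool (i = j) * v j))"
        using sum0 by (simp add: right_diff_distrib sum_subtractf)
      then have "\<bar>K i\<bar> * \<bar>v i\<bar> = \<bar>\<Sum>j<r. K j * (w j - of_bool (i = j) * v j)\<bar>"
        by (simp only: abs_minus_cancel flip: abs_mult)
      also have "\<dots> \<le> (\<Sum>j<r. \<bar>K j * (w j - of_bool (i = j) * v j)\<bar>)" by (rule sum_abs)
      also have "\<dots> \<le> (\<Sum>j<r. \<bar>K j\<bar> * (h i * \<bar>v i\<bar>))"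
      proof (intro sum_mono)
        fix j assume j: "j \<in> {..<r}"
        have "\<bar>w j - of_bool (i = j) * v j\<bar> \<le> h i * \<bar>v j\<bar>"
          using elim i j unfolding good_def w_def v_def by auto
        also have "\<dots> \<le> h i * \<bar>v i\<bar>" using max j hpos[OF i] by (intro mult_left_mono) auto
        finally show "\<bar>K j * (w j - of_bool (i = j) * v j)\<bar> \<le> \<bar>K j\<bar> * (h i * \<bar>v i\<bar>)"
          by (simp add: abs_mult mult_left_mono)
      qed
      also have "\<dots> \<le> C * (h i * \<bar>v i\<bar>)"
        unfolding sum_distrib_right[symmetric] C_def using hpos[OF i]
        by (intro mult_right_mono) auto
      also have "\<dots> = \<bar>K i\<bar> * \<bar>v i\<bar> / 2" using C by (simp add: h_def)
      finally have "\<bar>K i\<bar> * \<bar>v i\<bar> \<le> 0" by simp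
      then have "v i = 0" using K[of i] i by (simp add: s mult_le_0_iff)
      then have "v j = 0" if "j < r" for j using max[OF that] by simp
      then show ?thesis using top' by (auto simp: v_def s less_Suc_eq)
    qed
  qed
qed simp

lemma coordinatewise_convergent_subsequence:
  fixes f :: "nat \<Rightarrow> nat \<Rightarrow> real"
  assumes "\<And>n i. i < s \<Longrightarrow> f n i \<in> {0..1}"
  shows "\<exists>r. strict_mono r \<and> (\<forall>i<s. convergent (\<lambda>n. f (r n) i))"
  using assms
proof (induction s)
  case 0
  show ?case by (intro exI[of _ id]) (auto simp: strict_mono_def)
next
  case (Suc s)
  then obtain r where r: "strict_mono r" "\<And>i. i < s \<Longrightarrow> convergent (\<lambda>n. f (r n) i)"
    by (metis less_Suc_eq)
  have "seq_compact {0..1::real}" by (rule compact_imp_seq_compact) simp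
  then obtain q l where q: "strict_mono q" "((\<lambda>n. f (r n) s) \<circ> q) \<longlonglongrightarrow> l"
    using Suc.prems unfolding seq_compact_def by (metis lessI)
  have "convergent (\<lambda>n. f ((r \<circ> q) n) i)" if "i < Suc s" for i
  proof (cases "i = s")
    case True
    then show ?thesis using q(2) by (auto simp: convergent_def o_def)
  next
    case False
    then have "i < s" using that by simp
    then obtain l where "(\<lambda>n. f (r n) i) \<longlonglongrightarrow> l" using r(2) unfolding convergent_def by blast
    from LIMSEQ_subseq_LIMSEQ[OF this q(1)] show ?thesis by (auto simp: convergent_def o_def)
  qed
  moreover have "strict_mono (r \<circ> q)" using r(1) q(1) by (rule strict_mono_o)
  ultimately show ?case by blast
qed

text \<open>Restriction to extensional functions makes a node sequence determined by its \<open>s\<close> entries.\<close>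
definition normalized_nodes :: "nat \<Rightarrow> (nat \<Rightarrow> real) set" where
  "normalized_nodes s = {a \<in> extensional {..<s}.
     strict_mono_on {..<s} a \<and> (\<forall>i<s. 0 < a i) \<and> a (s - 1) = 1}"

text \<open>The equations pass to the limit, so only merging nodes and nodes tending to 0 have to be excluded.
  If either happens, the limit has fewer than \<open>s\<close> distinct nonzero nodes, and a polynomial of degree below
  \<open>s\<close> vanishes at 0 and at all of them except the last one, 1. The limit equation for it says
  that the weights of the nodes tending to 1 add up to 0; these weights form a tail.\<close>
lemma limit_of_nodes_nondegenerate:
  assumes s: "s \<ge> 1" and a: "\<And>n. a n \<in> normalized_nodes s" and ex: "\<And>n. extrapolates s K (a n)"
    and lim: "\<And>i. i < s \<Longrightarrow> (\<lambda>n. a n i) \<longlonglongrightarrow> b i"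
  shows "extrapolates s K b" "strict_mono_on {..<s} b" "\<And>i. i < s \<Longrightarrow> 0 < b i" "b (s - 1) = 1"
proof -
  have am: "strict_mono_on {..<s} (a n)" and ap: "i < s \<Longrightarrow> 0 < a n i" and at: "a n (s - 1) = 1" for n i
    using a[of n] by (auto simp: normalized_nodes_def)
  show exb: "extrapolates s K b"
    unfolding extrapolates_def
  proof (intro allI impI)
    fix p :: "real poly" assume "degree p < s"
    then have "(\<lambda>n. \<Sum>i<s. K i * poly p (a n i)) = (\<lambda>n. poly p 0)"
      using ex by (simp add: extrapolates_def)
    moreover have "(\<lambda>n. \<Sum>i<s. K i * poly p (a n i)) \<longlonglongrightarrow> (\<Sum>i<s. K i * poly p (b i))"
      using lim by (intro tendsto_intros) auto
    ultimately show "(\<Sum>i<s. K i * poly p (b i)) = poly p 0"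
      using LIMSEQ_unique tendsto_const by metis
  qed
  have "(\<lambda>n. 1) \<longlonglongrightarrow> b (s - 1)" using lim[of "s - 1"] s unfolding at by simp
  then show top: "b (s - 1) = 1" using LIMSEQ_unique tendsto_const by metis
  have nonneg: "0 \<le> b i" if "i < s" for i
    using lim[OF that] by (rule LIMSEQ_le_const) (use ap[OF that] in \<open>auto intro: less_imp_le\<close>)
  have bmono: "b i \<le> b j" if "i \<le> j" "j < s" for i j
  proof (cases "i = j")
    case False
    have "a n i \<le> a n j" for n
      using strict_mono_onD[OF am[of n], of i j] that False by auto
    then show ?thesis using that lim by (intro LIMSEQ_le[of "\<lambda>n. a n i" _ "\<lambda>n. a n j"]) auto
  qed simp
  define V where "V = b ` {..<s} - {0}"
  have finV: "finite V" by (simp add: V_def)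
  have "s \<le> card V"
  proof (rule ccontr)
    assume "\<not> s \<le> card V"
    define p where "p = [:0, 1:] * (\<Prod>v\<in>V - {1}. [:- v, 1:])"
    have oneV: "1 \<in> V" using top s unfolding V_def by (auto intro!: image_eqI[of _ _ "s - 1"])
    have "degree p \<le> 1 + degree (\<Prod>v\<in>V - {1}. [:- v, 1:])"
      unfolding p_def by (rule order.trans[OF degree_mult_le]) simp
    also have "degree (\<Prod>v\<in>V - {1}. [:- v, 1:]) \<le> (\<Sum>v\<in>V - {1}. 1)"
      using finV by (intro order.trans[OF degree_prod_sum_le]) (auto intro!: sum_mono)
    also have "1 + (\<Sum>v\<in>V - {1}. 1) = card V"
      using oneV finV card_gt_0_iff[of V] by (auto simp: card_Diff_singleton)
    finally have "degree p < s" using \<open>\<not> s \<le> card V\<close> by simp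
    then have eq: "(\<Sum>i<s. K i * poly p (b i)) = 0"
      using exb unfolding extrapolates_def by (simp add: p_def[THEN arg_cong, of "\<lambda>p. poly p 0"])
    have root: "poly p (b i) = 0" if "i < s" "b i \<noteq> 1" for i
    proof (cases "b i = 0")
      case False
      then have "b i \<in> V - {1}" using that by (simp add: V_def)
      then show ?thesis using finV by (auto simp: p_def poly_prod intro: bexI[of _ "b i"])
    qed (simp add: p_def)
    define k where "k = (LEAST i. b i = 1)"
    have bk: "b k = 1" unfolding k_def using top by (rule LeastI)
    have ks: "k < s" using Least_le[of "\<lambda>i. b i = 1", OF top] s unfolding k_def by simp
    have b1: "b i = 1 \<longleftrightarrow> k \<le> i" if "i < s" for i
    proof
      show "b i = 1 \<Longrightarrow> k \<le> i" unfolding k_def by (rule Least_le)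
      assume "k \<le> i"
      then have "b k \<le> b i" "b i \<le> b (s - 1)" using that by (auto intro: bmono)
      then show "b i = 1" using bk top by simp
    qed
    have "K i * poly p (b i) = (if k \<le> i then K i * poly p 1 else 0)" if "i < s" for i
      using root[OF that] b1[OF that] by (cases "b i = 1") auto
    then have "(\<Sum>i<s. K i * poly p (b i)) = (\<Sum>i\<in>{k..<s}. K i * poly p 1)"
      by (intro sum.mono_neutral_cong_right) auto
    then have "(\<Sum>i\<in>{k..<s}. K i) * poly p 1 = 0" using eq by (simp add: sum_distrib_right)
    moreover have "poly p 1 \<noteq> 0" using finV by (auto simp: p_def poly_prod)
    moreover have "(\<Sum>i\<in>{k..<s}. K i) \<noteq> 0"
      by (rule tail_sum_nonzero[OF ex[of 0] am ap ks])
    ultimately show False by simp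
  qed
  moreover have "card V \<le> card (b ` {..<s})" unfolding V_def by (rule card_Diff1_le)
  moreover have "card (b ` {..<s}) \<le> s" using card_image_le[of "{..<s}" b] by simp
  ultimately have cards: "card V = s" "card (b ` {..<s}) = s" by auto
  then have inj: "inj_on b {..<s}" by (intro eq_card_imp_inj_on) auto
  have "0 \<notin> b ` {..<s}"
  proof
    assume "0 \<in> b ` {..<s}"
    then have "card V < card (b ` {..<s})" unfolding V_def by (intro card_Diff1_less) auto
    then show False using cards by simp
  qed
  then show "0 < b i" if "i < s" for i
    using nonneg[OF that] that by (metis imageI lessThan_iff order_le_less)
  show "strict_mono_on {..<s} b"
  proof (rule strict_mono_onI)
    fix i j assume "i \<in> {..<s}" "j \<in> {..<s}" "i < j"
    then show "b i < b j" using bmono[of i j] inj_onD[OF inj, of i j] by fastforce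
  qed
qed

lemma finite_nodes_of_weights:
  assumes s: "s \<ge> 1"
  shows "finite {a \<in> normalized_nodes s. extrapolates s K a}"
proof (rule ccontr)
  assume "infinite {a \<in> normalized_nodes s. extrapolates s K a}"
  from infinite_countable_subset[OF this] obtain f :: "nat \<Rightarrow> nat \<Rightarrow> real"
    where inj: "inj f" and f: "\<And>n. f n \<in> normalized_nodes s" "\<And>n. extrapolates s K (f n)"
    by auto
  have "f n i \<in> {0..1}" if "i < s" for n i
  proof -
    have m: "strict_mono_on {..<s} (f n)" and p: "0 < f n i" and t: "f n (s - 1) = 1"
      using f(1)[of n] that by (auto simp: normalized_nodes_def)
    have "f n i \<le> f n (s - 1)"
      using strict_mono_onD[OF m, of i "s - 1"] that by (cases "i = s - 1") (auto intro: less_imp_le)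
    then show ?thesis using p t by simp
  qed
  then obtain r where r: "strict_mono r" "\<And>i. i < s \<Longrightarrow> convergent (\<lambda>n. f (r n) i)"
    using coordinatewise_convergent_subsequence by metis
  define b where "b i = lim (\<lambda>n. f (r n) i)" for i
  have lim: "(\<lambda>n. f (r n) i) \<longlonglongrightarrow> b i" if "i < s" for i
    using r(2)[OF that] unfolding b_def by (simp add: convergent_LIMSEQ_iff)
  note b = limit_of_nodes_nondegenerate[OF s f(1) f(2) lim]
  have "\<forall>\<^sub>F n in sequentially. \<forall>i<s. f (r n) i = b i"
  proof (rule local_rigidity[OF b(1) b(2) b(3) f(2) _ lim])
    show "f (r n) (s - 1) = b (s - 1)" for n
      using f(1)[of "r n"] b(4) by (simp add: normalized_nodes_def)
  qed
  then obtain N where N: "\<And>n i. n \<ge> N \<Longrightarrow> i < s \<Longrightarrow> f (r n) i = b i"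
    unfolding eventually_sequentially by blast
  have "f (r N) = f (r (Suc N))"
    using f(1)[of "r N"] f(1)[of "r (Suc N)"] N
    by (intro extensionalityI[of _ "{..<s}"]) (auto simp: normalized_nodes_def)
  then have "r N = r (Suc N)" using inj by (simp add: inj_eq)
  then show False using strict_mono_eq[OF r(1)] by simp
qed


section \<open>Finite sets with finitely many distance ratios\<close>

text \<open>The reflection in the hyperplane of points equidistant from \<open>p\<close> and \<open>q\<close>.\<close>
lemma exists_reflection:
  fixes p q :: "'a::real_inner"
  assumes "p \<noteq> q"
  obtains \<phi> where "\<And>x y. dist (\<phi> x) (\<phi> y) = dist x y" "\<phi> p = q"
    "\<And>z. dist z p = dist z q \<Longrightarrow> \<phi> z = z"
proof -
  define w where "w = p - q"
  define m where "m = (1/2) *\<^sub>R (p + q)"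
  have w: "w \<bullet> w > 0" using assms by (simp add: w_def)
  define \<phi> where "\<phi> z = z - (2 * ((z - m) \<bullet> w) / (w \<bullet> w)) *\<^sub>R w" for z
  have "dist (\<phi> x) (\<phi> y) = dist x y" for x y
  proof -
    define d where "d = x - y"
    have "(x - m) \<bullet> w - (y - m) \<bullet> w = d \<bullet> w" by (simp add: d_def inner_diff_left)
    then have e: "\<phi> x - \<phi> y = d - (2 * (d \<bullet> w) / (w \<bullet> w)) *\<^sub>R w"
      unfolding \<phi>_def d_def
      by (simp add: algebra_simps diff_divide_distrib flip: scaleR_diff_left)
        (simp add: inner_diff_left diff_divide_distrib algebra_simps)
    have "(norm (\<phi> x - \<phi> y))\<^sup>2 = (norm d)\<^sup>2"
      unfolding e power2_norm_eq_inner using w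
      by (simp add: inner_diff_left inner_diff_right inner_commute[of w d] field_simps)
    then show ?thesis by (simp add: dist_norm d_def)
  qed
  moreover have "\<phi> p = q"
  proof -
    have "p - m = (1/2) *\<^sub>R w" by (simp add: m_def w_def algebra_simps flip: scaleR_left.add)
    then have "\<phi> p = p - w" using w by (simp add: \<phi>_def)
    then show ?thesis by (simp add: w_def)
  qed
  moreover have "\<phi> z = z" if "dist z p = dist z q" for z
  proof -
    have "(z - p) \<bullet> (z - p) = (z - q) \<bullet> (z - q)"
      using that by (metis dist_norm power2_norm_eq_inner)
    then have "(z - m) \<bullet> w = 0"
      by (simp add: m_def w_def inner_diff_left inner_diff_right inner_add_left inner_commute algebra_simps)
    then show ?thesis by (simp add: \<phi>_def)
  qed
  ultimately show ?thesis by (rule that)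
qed

text \<open>The points are put into place one at a time. All images placed so far are equidistant from the
  current and the desired position of the next point, so the reflection exchanging these two positions
  leaves them fixed.\<close>
lemma extend_finite_isometry:
  fixes f :: "'a::real_inner \<Rightarrow> 'a"
  assumes "finite S" "\<And>x y. x \<in> S \<Longrightarrow> y \<in> S \<Longrightarrow> dist (f x) (f y) = dist x y"
  shows "\<exists>\<phi>. (\<forall>x y. dist (\<phi> x) (\<phi> y) = dist x y) \<and> (\<forall>x\<in>S. \<phi> x = f x)"
  using assms
proof (induction S rule: finite_induct)
  case empty
  show ?case by (intro exI[of _ id]) simp
next
  case (insert x S)
  then obtain \<phi> where \<phi>: "\<And>y z. dist (\<phi> y) (\<phi> z) = dist y z" "\<And>y. y \<in> S \<Longrightarrow> \<phi> y = f y"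
    by (metis insertCI)
  show ?case
  proof (cases "\<phi> x = f x")
    case True
    then show ?thesis using \<phi> by (intro exI[of _ \<phi>]) auto
  next
    case False
    then obtain \<rho> where \<rho>: "\<And>y z. dist (\<rho> y) (\<rho> z) = dist y z" "\<rho> (\<phi> x) = f x"
      "\<And>z. dist z (\<phi> x) = dist z (f x) \<Longrightarrow> \<rho> z = z"
      using exists_reflection by blast
    have "\<rho> (\<phi> y) = f y" if "y \<in> S" for y
    proof -
      have "dist (f y) (\<phi> x) = dist (f y) (f x)"
        using \<phi>(1)[of y x] \<phi>(2)[OF that] insert.prems[of y x] that by simp
      then show ?thesis using \<rho>(3) \<phi>(2)[OF that] by simp
    qed
    then show ?thesis using \<rho>(1,2) \<phi>(1) by (intro exI[of _ "\<rho> \<circ> \<phi>"]) auto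
  qed
qed

lemma similarI:
  fixes X Y :: "(real ^ 'd) set"
  assumes X: "finite X" and r: "r > 0" and Y: "Y = f ` X"
    and d: "\<And>x y. x \<in> X \<Longrightarrow> y \<in> X \<Longrightarrow> dist (f x) (f y) = r * dist x y"
  shows "similar X Y"
proof -
  have "dist ((1/r) *\<^sub>R f x) ((1/r) *\<^sub>R f y) = dist x y" if "x \<in> X" "y \<in> X" for x y
    using d[OF that] r by (simp add: dist_norm flip: scaleR_diff_right)
  from extend_finite_isometry[OF X this] obtain \<phi> where
    \<phi>: "\<And>x y. dist (\<phi> x) (\<phi> y) = dist x y" "\<And>x. x \<in> X \<Longrightarrow> \<phi> x = (1/r) *\<^sub>R f x"
    by auto
  have "orthogonal_transformation (\<lambda>x. \<phi> x - \<phi> 0)"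
    unfolding orthogonal_transformation_isometry using \<phi>(1) by (simp add: dist_norm)
  moreover have "Y = (\<lambda>x. r *\<^sub>R (\<phi> x - \<phi> 0) + r *\<^sub>R \<phi> 0) ` X"
    unfolding Y using r \<phi>(2) by (intro image_cong) (auto simp: algebra_simps)
  ultimately show ?thesis unfolding similar_def using r by blast
qed

lemma finite_quotient_by_invariant:
  assumes r: "equiv UNIV r" and fin: "finite (\<Phi> ` F)"
    and inv: "\<And>X Y. X \<in> F \<Longrightarrow> Y \<in> F \<Longrightarrow> \<Phi> X = \<Phi> Y \<Longrightarrow> (X, Y) \<in> r"
  shows "finite (F // r)"
proof -
  have "F // r \<subseteq> (\<lambda>d. r `` {SOME X. X \<in> F \<and> \<Phi> X = d}) ` (\<Phi> ` F)"
  proof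
    fix C assume "C \<in> F // r"
    then obtain X where X: "X \<in> F" "C = r `` {X}" by (auto simp: quotient_def)
    define Y where "Y = (SOME Y. Y \<in> F \<and> \<Phi> Y = \<Phi> X)"
    have "Y \<in> F \<and> \<Phi> Y = \<Phi> X" unfolding Y_def by (rule someI[of _ X]) (use X in simp)
    then have "C = r `` {Y}" using inv[of X Y] X equiv_class_eq[OF r] by simp
    then show "C \<in> (\<lambda>d. r `` {SOME X. X \<in> F \<and> \<Phi> X = d}) ` (\<Phi> ` F)"
      using X(1) unfolding Y_def by blast
  qed
  then show ?thesis using fin finite_subset by blast
qed

text \<open>The invariant is the matrix of normalized squared distances, for an arbitrarily chosen labelling
  of each set. Its entries come from a finite set, and sets with equal matrices are similar.\<close>
lemma finite_similarity_classes:
  fixes F :: "(real ^ 'd) set set"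
  assumes A: "finite A" and fin: "\<And>X. X \<in> F \<Longrightarrow> finite X" and card: "\<And>X. X \<in> F \<Longrightarrow> card X \<le> B"
    and ratio: "\<And>X. X \<in> F \<Longrightarrow> \<exists>\<delta>>0. \<forall>x\<in>X. \<forall>y\<in>X. x \<noteq> y \<longrightarrow> (dist x y / \<delta>)\<^sup>2 \<in> A"
  shows "finite (F // similarity)"
proof -
  have "\<exists>e. bij_betw e {..<card X} X" if "X \<in> F" for X
    using ex_bij_betw_nat_finite[OF fin[OF that]] unfolding lessThan_atLeast0 .
  then obtain e where e: "\<And>X. X \<in> F \<Longrightarrow> bij_betw (e X) {..<card X} X" by metis
  obtain \<delta> where \<delta>: "\<And>X. X \<in> F \<Longrightarrow> \<delta> X > 0"
    "\<And>X x y. X \<in> F \<Longrightarrow> x \<in> X \<Longrightarrow> y \<in> X \<Longrightarrow> x \<noteq> y \<Longrightarrow> (dist x y / \<delta> X)\<^sup>2 \<in> A"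
    using ratio by metis
  define \<Phi> where "\<Phi> X = (card X, \<lambda>(i, j)\<in>{..<card X} \<times> {..<card X}. (dist (e X i) (e X j) / \<delta> X)\<^sup>2)" for X
  have eX: "e X i \<in> X" if "X \<in> F" "i < card X" for X i
    using bij_betwE[OF e[OF that(1)]] that(2) by simp
  have "\<Phi> ` F \<subseteq> Sigma {..B} (\<lambda>n. ({..<n} \<times> {..<n}) \<rightarrow>\<^sub>E insert 0 A)"
  proof
    fix d assume "d \<in> \<Phi> ` F"
    then obtain X where X: "X \<in> F" "d = \<Phi> X" by blast
    have "(dist (e X i) (e X j) / \<delta> X)\<^sup>2 \<in> insert 0 A" if "i < card X" "j < card X" for i j
      using \<delta>(2)[OF X(1), of "e X i" "e X j"] eX[OF X(1)] that by (cases "e X i = e X j") auto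
    then show "d \<in> Sigma {..B} (\<lambda>n. ({..<n} \<times> {..<n}) \<rightarrow>\<^sub>E insert 0 A)"
      using card[OF X(1)] by (auto simp: X(2) \<Phi>_def restrict_PiE_iff simp del: insert_iff)
  qed
  moreover have "finite (Sigma {..B} (\<lambda>n. ({..<n} \<times> {..<n}) \<rightarrow>\<^sub>E insert 0 A))"
    using A by (intro finite_SigmaI finite_PiE) auto
  ultimately have "finite (\<Phi> ` F)" by (rule finite_subset)
  moreover have "(X, Y) \<in> similarity" if X: "X \<in> F" and Y: "Y \<in> F" and eq: "\<Phi> X = \<Phi> Y" for X Y
  proof -
    define n where "n = card X"
    have n: "card Y = n" using eq by (simp add: \<Phi>_def n_def)
    have eq': "(dist (e X i) (e X j) / \<delta> X)\<^sup>2 = (dist (e Y i) (e Y j) / \<delta> Y)\<^sup>2" if "i < n" "j < n" for i j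
    proof -
      have "snd (\<Phi> X) (i, j) = snd (\<Phi> Y) (i, j)" using eq by simp
      then show ?thesis using that n by (simp add: \<Phi>_def n_def)
    qed
    have bX: "bij_betw (e X) {..<n} X" and bY: "bij_betw (e Y) {..<n} Y"
      using e[OF X] e[OF Y] n by (simp_all add: n_def)
    define f where "f = e Y \<circ> inv_into {..<n} (e X)"
    have fe: "f (e X i) = e Y i" if "i < n" for i
      using bX that by (simp add: f_def bij_betw_def)
    have rep: "\<exists>i<n. x = e X i" if "x \<in> X" for x
      using bX that by (auto simp: bij_betw_def)
    have "bij_betw f X Y" unfolding f_def
      by (rule bij_betw_trans[OF bij_betw_inv_into[OF bX] bY])
    then have img: "Y = f ` X" by (simp add: bij_betw_def)
    have dist: "dist (f x) (f y) = (\<delta> Y / \<delta> X) * dist x y" if xy: "x \<in> X" "y \<in> X" for x y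
    proof -
      obtain i j where ij: "i < n" "x = e X i" "j < n" "y = e X j" using rep xy by blast
      have "dist x y / \<delta> X = dist (f x) (f y) / \<delta> Y"
        using eq'[OF ij(1,3)] \<delta>(1)[OF X] \<delta>(1)[OF Y]
        unfolding ij(2,4) fe[OF ij(1)] fe[OF ij(3)]
        by (subst (asm) power2_eq_iff_nonneg) auto
      then show ?thesis using \<delta>(1)[OF X] \<delta>(1)[OF Y] by (simp add: field_simps)
    qed
    have "similar X Y"
      by (rule similarI[OF fin[OF X] _ img dist]) (use \<delta>(1)[OF X] \<delta>(1)[OF Y] in simp)
    then show ?thesis by (simp add: similarity_def)
  qed
  ultimately show ?thesis by (rule finite_quotient_by_invariant[OF equiv_similarity])
qed


section \<open>Finiteness of large few-distance sets\<close>

lemma finite_distances: "finite X \<Longrightarrow> finite (distances X)"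
  by (rule finite_subset[of _ "(\<lambda>(x, y). norm (x - y)) ` (X \<times> X)"]) (auto simp: distances_def)

lemma distances_pos: "r \<in> distances X \<Longrightarrow> 0 < r"
  by (auto simp: distances_def)

text \<open>The polynomial vanishing at all squared distances is nonzero at 0, so it isolates a single value of
  an annihilating weight. Such a weight must therefore be zero, which bounds the number of points by
  the number of monomials.\<close>
lemma card_s_distance_set_le:
  fixes X :: "(real ^ 'd) set"
  assumes "s_distance_set s X"
  shows "card X \<le> card {m :: ('d \<Rightarrow> nat) \<times> bool. monomial_degree m \<le> s}"
proof (rule ccontr)
  have X: "finite X" and D: "card (distances X) = s" using assms by (auto simp: s_distance_set_def)
  assume "\<not> ?thesis"
  then have big: "card {m :: ('d \<Rightarrow> nat) \<times> bool. monomial_degree m \<le> s} < card X" by simp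
  obtain u z where z: "z \<in> X" "u z \<noteq> 0"
    and ann: "\<And>p c x. degree p \<le> s \<Longrightarrow> (\<Sum>y\<in>X. poly p (c * (norm (x - y))\<^sup>2) * u y) = 0"
    by (rule exists_distance_polynomial_annihilator[OF X big]) (rule that; assumption)
  define p where "p = (\<Prod>r\<in>distances X. [:- r\<^sup>2, 1:])"
  have "degree p \<le> (\<Sum>r\<in>distances X. 1)"
    unfolding p_def using finite_distances[OF X]
    by (intro order.trans[OF degree_prod_sum_le]) (auto intro!: sum_mono)
  then have "degree p \<le> s" using D by simp
  from ann[OF this, of 1 z] have "0 = (\<Sum>y\<in>X. poly p ((norm (z - y))\<^sup>2) * u y)" by simp
  also have "\<dots> = (\<Sum>y\<in>X. if y = z then poly p 0 * u z else 0)"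
  proof (intro sum.cong refl)
    fix y assume y: "y \<in> X"
    have "poly p ((norm (z - y))\<^sup>2) = 0" if "y \<noteq> z"
    proof -
      have "norm (z - y) \<in> distances X" using that y z(1) by (auto simp: distances_def)
      then show ?thesis using finite_distances[OF X] by (auto simp: p_def poly_prod)
    qed
    then show "poly p ((norm (z - y))\<^sup>2) * u y = (if y = z then poly p 0 * u z else 0)" by auto
  qed
  also have "\<dots> = poly p 0 * u z" using X z(1) by simp
  finally have "poly p 0 = 0" using z(2) by simp
  then show False
    using finite_distances[OF X] distances_pos[of _ X] by (fastforce simp: p_def poly_prod)
qed

lemma obtain_normalized_nodes:
  assumes "finite Q" "card Q = s" "1 \<in> Q" "\<And>q. q \<in> Q \<Longrightarrow> 0 < q \<and> q \<le> (1::real)"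
  obtains a where "a \<in> normalized_nodes s" "a ` {..<s} = Q"
proof -
  define xs where "xs = sorted_list_of_set Q"
  have xs: "sorted_wrt (<) xs" "set xs = Q" "length xs = s"
    using assms by (simp_all add: xs_def)
  define a where "a = restrict ((!) xs) {..<s}"
  have img: "a ` {..<s} = Q"
    using xs(2,3) by (auto simp: a_def set_conv_nth)
  have mono: "strict_mono_on {..<s} a"
    using sorted_wrt_nth_less[OF xs(1)] xs(3) by (auto simp: a_def intro!: strict_mono_onI)
  obtain i where i: "i < s" "a i = 1" using img assms(3) by auto
  have "a (s - 1) \<in> Q" using img i(1) by auto
  then have "a (s - 1) \<le> 1" using assms(4) by blast
  moreover have "1 \<le> a (s - 1)"
    using strict_mono_onD[OF mono, of i "s - 1"] i by (cases "i = s - 1") (auto intro: less_imp_le)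
  ultimately have "a \<in> normalized_nodes s"
    using mono img assms(4) by (auto simp: normalized_nodes_def a_def)
  then show ?thesis using img that by blast
qed

text \<open>On the normalized squared distances of \<open>X\<close>, the Lagrange basis polynomial of \<open>a\<^sub>i\<close> is the adjacency
  relation "at distance \<open>a\<^sub>i\<close>", up to its value \<open>K\<^sub>i\<close> on the diagonal. The annihilating weight is
  thus an eigenvector of this relation for the eigenvalue \<open>- K\<^sub>i\<close>.\<close>
lemma lagrange_weight_mem:
  fixes X :: "(real ^ 'd) set"
  assumes X: "finite X" "card X \<le> B"
    and big: "card {m :: ('d \<Rightarrow> nat) \<times> bool. monomial_degree m \<le> s - 1} < card X"
    and a: "a \<in> normalized_nodes s" and i: "i < s"
    and nodes: "\<And>x y. x \<in> X \<Longrightarrow> y \<in> X \<Longrightarrow> x \<noteq> y \<Longrightarrow> (norm (x - y) / \<delta>)\<^sup>2 \<in> a ` {..<s}"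
  shows "- poly (lagrange_basis s a i) 0 \<in> adjacency_eigenvalues B"
proof -
  obtain u z where z: "z \<in> X" "u z \<noteq> 0"
    and ann: "\<And>p c x. degree p \<le> s - 1 \<Longrightarrow> (\<Sum>y\<in>X. poly p (c * (norm (x - y))\<^sup>2) * u y) = 0"
    by (rule exists_distance_polynomial_annihilator[OF X(1) big]) (rule that; assumption)
  have inj: "inj_on a {..<s}" and pos: "\<And>j. j < s \<Longrightarrow> 0 < a j"
    using a by (auto simp: normalized_nodes_def intro: strict_mono_on_imp_inj_on)
  define k where "k = poly (lagrange_basis s a i) 0"
  define R where "R x y \<longleftrightarrow> (norm (x - y) / \<delta>)\<^sup>2 = a i" for x y :: "real ^ 'd"
  have ev: "(\<Sum>y\<in>X. of_bool (R x y) * u y) = - k * u x" if x: "x \<in> X" for x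
  proof -
    have val: "poly (lagrange_basis s a i) (1 / \<delta>\<^sup>2 * (norm (x - y))\<^sup>2)
        = of_bool (R x y) + (if y = x then k else 0)" if y: "y \<in> X" for y
    proof (cases "y = x")
      case True
      then show ?thesis using pos[OF i] by (simp add: R_def k_def)
    next
      case False
      then obtain j where j: "j < s" "(norm (x - y) / \<delta>)\<^sup>2 = a j" using nodes[OF x y] by auto
      have "i = j \<longleftrightarrow> a i = a j" using inj_onD[OF inj, of i j] i j(1) by auto
      then show ?thesis
        using False j poly_lagrange_basis_node[OF inj i j(1)]
        by (auto simp: R_def power_divide)
    qed
    have "degree (lagrange_basis s a i) \<le> s - 1" using degree_lagrange_basis[OF i, of a] by simp
    from ann[OF this, of "1 / \<delta>\<^sup>2" x]
    have "0 = (\<Sum>y\<in>X. (of_bool (R x y) + (if y = x then k else 0)) * u y)"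
      using val by (simp cong: sum.cong)
    also have "\<dots> = (\<Sum>y\<in>X. of_bool (R x y) * u y) + (\<Sum>y\<in>X. if y = x then k * u x else 0)"
      unfolding sum.distrib[symmetric] by (intro sum.cong) (auto simp: distrib_right)
    also have "\<dots> = (\<Sum>y\<in>X. of_bool (R x y) * u y) + k * u x" using X(1) x by simp
    finally show ?thesis by simp
  qed
  show ?thesis using adjacency_eigenvaluesI[of X B z u R, OF X z ev] by (simp add: k_def)
qed

text \<open>All values that a normalized squared distance can take when there are at most \<open>B\<close> points; the
  weights \<open>K\<close> range over negated eigenvalues, in accordance with the eigenvalue \<open>- K\<^sub>i\<close> above.\<close>
definition possible_ratios :: "nat \<Rightarrow> nat \<Rightarrow> real set" where
  "possible_ratios s B = (\<Union>K\<in>{..<s} \<rightarrow>\<^sub>E uminus ` adjacency_eigenvalues B.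
     \<Union>a\<in>{a \<in> normalized_nodes s. extrapolates s K a}. a ` {..<s})"

lemma finite_possible_ratios: "s \<ge> 1 \<Longrightarrow> finite (possible_ratios s B)"
  unfolding possible_ratios_def
  by (intro finite_UN_I finite_PiE finite_imageI finite_adjacency_eigenvalues finite_nodes_of_weights)
    auto

lemma distance_ratios_mem:
  fixes X :: "(real ^ 'd) set"
  assumes s: "s \<ge> 1" and sX: "s_distance_set s X" and B: "card X \<le> B"
    and big: "card X \<ge> 2 * ((CARD('d) + s - 1) choose (s - 1))"
  shows "\<exists>\<delta>>0. \<forall>x\<in>X. \<forall>y\<in>X. x \<noteq> y \<longrightarrow> (dist x y / \<delta>)\<^sup>2 \<in> possible_ratios s B"
proof -
  have X: "finite X" and D: "card (distances X) = s" using sX by (auto simp: s_distance_set_def)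
  have fD: "finite (distances X)" using X by (rule finite_distances)
  have ne: "distances X \<noteq> {}" using D s by auto
  define \<delta> where "\<delta> = Max (distances X)"
  have \<delta>_in: "\<delta> \<in> distances X" unfolding \<delta>_def using fD ne by (rule Max_in)
  have \<delta>_ge: "r \<le> \<delta>" if "r \<in> distances X" for r unfolding \<delta>_def using fD that by (rule Max_ge)
  have \<delta>: "\<delta> > 0" using distances_pos[OF \<delta>_in] .
  define Q where "Q = (\<lambda>r. (r / \<delta>)\<^sup>2) ` distances X"
  have "inj_on (\<lambda>r. (r / \<delta>)\<^sup>2) (distances X)"
  proof (rule inj_onI)
    fix q r assume "q \<in> distances X" "r \<in> distances X" and eq: "(q / \<delta>)\<^sup>2 = (r / \<delta>)\<^sup>2"
    then have "0 < q" "0 < r" using distances_pos by blast+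
    with eq \<delta> have "q / \<delta> = r / \<delta>" by (subst (asm) power2_eq_iff_nonneg) auto
    then show "q = r" using \<delta> by simp
  qed
  then have cQ: "card Q = s" unfolding Q_def using D by (simp add: card_image)
  have Q1: "1 \<in> Q" unfolding Q_def using \<delta>_in \<delta> by (auto intro!: image_eqI[of _ _ \<delta>])
  have Qpos: "0 < q \<and> q \<le> 1" if "q \<in> Q" for q
  proof -
    obtain r where r: "r \<in> distances X" "q = (r / \<delta>)\<^sup>2" using \<open>q \<in> Q\<close> by (auto simp: Q_def)
    have "0 < r / \<delta>" "r / \<delta> \<le> 1" using distances_pos[OF r(1)] \<delta>_ge[OF r(1)] \<delta> by auto
    then show ?thesis unfolding r(2) by (intro conjI zero_less_power power_le_one) auto
  qed
  obtain a where a: "a \<in> normalized_nodes s" "a ` {..<s} = Q"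
    using obtain_normalized_nodes[OF _ cQ Q1 Qpos] fD by (auto simp: Q_def)
  have nodes: "(norm (x - y) / \<delta>)\<^sup>2 \<in> a ` {..<s}" if "x \<in> X" "y \<in> X" "x \<noteq> y" for x y
    unfolding a(2) Q_def using that by (auto simp: distances_def)
  define K where "K = (\<lambda>i\<in>{..<s}. poly (lagrange_basis s a i) 0)"
  have "card {m :: ('d \<Rightarrow> nat) \<times> bool. monomial_degree m \<le> s - 1} < card X"
    using card_bounded_monomials[where 'd = 'd and t = "s - 1"] big s by simp
  from lagrange_weight_mem[OF X B this a(1) _ nodes]
  have "K \<in> {..<s} \<rightarrow>\<^sub>E uminus ` adjacency_eigenvalues B"
    by (auto simp: K_def intro!: image_eqI[of _ uminus "- poly (lagrange_basis s a _) 0"])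
  moreover have "inj_on a {..<s}"
    using a(1) by (auto simp: normalized_nodes_def intro: strict_mono_on_imp_inj_on)
  from extrapolates_lagrange_weights[OF this] have "extrapolates s K a"
    by (simp add: extrapolates_def K_def)
  ultimately have "a ` {..<s} \<subseteq> possible_ratios s B"
    using a(1) unfolding possible_ratios_def by blast
  then show ?thesis using nodes \<delta> unfolding dist_norm by (intro exI[of _ \<delta>]) blast
qed

theorem theorem4p2:
  fixes s :: nat
  assumes "s \<ge> 1"
  shows "finite ({X :: (real ^ 'd) set. s_distance_set s X \<and>
    card X \<ge> 2 * ((CARD('d) + s - 1) choose (s - 1))} // similarity)"
proof (rule finite_similarity_classes)
  let ?B = "card {m :: ('d \<Rightarrow> nat) \<times> bool. monomial_degree m \<le> s}"
  show "finite (possible_ratios s ?B)" using assms by (rule finite_possible_ratios)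
  fix X :: "(real ^ 'd) set"
  assume "X \<in> {X. s_distance_set s X \<and> card X \<ge> 2 * ((CARD('d) + s - 1) choose (s - 1))}"
  then have X: "s_distance_set s X" "card X \<ge> 2 * ((CARD('d) + s - 1) choose (s - 1))" by auto
  then show "finite X" by (simp add: s_distance_set_def)
  show B: "card X \<le> ?B" by (rule card_s_distance_set_le[OF X(1)])
  show "\<exists>\<delta>>0. \<forall>x\<in>X. \<forall>y\<in>X. x \<noteq> y \<longrightarrow> (dist x y / \<delta>)\<^sup>2 \<in> possible_ratios s ?B"
    by (rule distance_ratios_mem[OF assms X(1) B X(2)])
qed

end
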